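(* Let $G=(V,E)$ be a finite one-way Sperner directed metric graph with source $s$, let $c_1,\dots,c_k$ be its elementary (directed) cycles, and for each $v\in V$ let $l_v$ be the unique simple directed chain from $s$ to $v$ (with $l_s=\emptyset$, $t(l_s)=0$). Assume that the passage times $t(c_1),\dots,t(c_k)$ together with the passage times $t(l_v)$, $v\in V\setminus\{s\}$, are linearly independent over $\mathbb{Q}$. Let $N(T)$ be the number of possible endpoints at time $T$ of the walk on $G$ starting at $s$ at time $0$. Then \[ N(T)=\sum_{v\in V}\ \sum_{I\subset\{1,\ldots,k\}}\Big(\rho_{out}(G,v)-\rho_{in}(G'(v,I),v)\Big)\,\#\Big\{t(l_v)+\sum_{i\in I}n_i\,t(c_i)\le T\Big\}, \] where $G'(v,I)$ is the subgraph of $G$ formed by the union of the edges of $l_v$ and of the cycles $c_i$, $i\in I$.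
   Context: A directed metric graph is a finite directed graph in which each edge $e$ is assigned a positive length (passage time) $t(e)$. A one-way Sperner graph is a strongly connected directed metric graph obtained from a directed tree oriented away from a root vertex $s$ (the source) by adding finitely many edges, each of which goes from some vertex to $s$. In such a graph, for every vertex $v$ there is a unique simple chain $l_v$ (route with pairwise distinct vertices) from $s$ to $v$, and the number $k$ of elementary cycles equals the number of edges entering $s$. Walk: a point starts at $s$ at time $0$ and moves along edges in their direction, traversing each edge $e$ in time $t(e)$; at each vertex it may continue along any outgoing edge (each with nonzero probability); reversing direction inside an edge is forbidden. The endpoint at time $T$ is a point of the metric graph (possibly interior to an edge); $N(T)$ is the number of distinct such points reachable at time $T$ over all choices. For a route $\mu$, $t(\mu)$ is the sum of passage times of its edges. For a subgraph $G'$ and vertex $v$, $\rho_{in}(G',v)$ and $\rho_{out}(G',v)$ denote the numbers of edges of $G'$ entering and leaving $v$. For positive reals $a_i$, $\#\{b+\sum_{i\in I}n_ia_i\le T\}$ denotes the number of tuples $(n_i)_{i\in I}$ of natural numbers $n_i\in\{1,2,\dots\}$ satisfying the inequality (for $I=\emptyset$ it equals $1$ if $b\le T$ and $0$ otherwise).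
   Formalization: The equality at T fails when the walk can be exactly at a vertex with out-degree other than 1 (e.g. T=0 with two loops at s: N=1, sum=2); it is proved at all other T≥0, and for every T≥0 it is proved that N(T') equals the right-hand side at T for all T'>T close to T. *)

theory Defs
  imports "HOL-Analysis.Analysis" "Graph_Theory.Graph_Theory"
begin

text \<open>
  Digraphs may have loops and parallel arcs.
  The constant \<open>tree\<close> of Graph_Theory only excludes directed cycles, hence the separate notion
  of a rooted out-tree.
\<close>

definition out_tree :: "('a, 'b) pre_digraph \<Rightarrow> 'a \<Rightarrow> bool" where
  "out_tree G s \<longleftrightarrow> wf_digraph G \<and> s \<in> verts G \<and>
     (\<forall>v\<in>verts G. \<exists>!p. pre_digraph.awalk G s p v)"

definition one_way_sperner :: "('a, 'b) pre_digraph \<Rightarrow> 'a \<Rightarrow> bool" where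
  "one_way_sperner G s \<longleftrightarrow> fin_digraph G \<and> strongly_connected G \<and>
     (\<exists>B \<subseteq> in_arcs G s. out_tree (G\<lparr>arcs := arcs G - B\<rparr>) s)"

definition simple_chain :: "('a, 'b) pre_digraph \<Rightarrow> 'a \<Rightarrow> 'a \<Rightarrow> 'b list" where
  "simple_chain G s v = (THE p. pre_digraph.apath G s p v)"

text \<open>
  Elementary cycles are taken up to the choice of the starting vertex. The arcs of an elementary
  cycle are pairwise distinct and determine it up to rotation, so it is represented by its arc set.
\<close>

definition elem_cycles :: "('a, 'b) pre_digraph \<Rightarrow> 'b set set" where
  "elem_cycles G = {set p |p. pre_digraph.cycle G p}"

definition arcs_subgraph :: "('a, 'b) pre_digraph \<Rightarrow> 'b set \<Rightarrow> ('a, 'b) pre_digraph" where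
  "arcs_subgraph G A =
     \<lparr>verts = tail G ` A \<union> head G ` A, arcs = A, tail = tail G, head = head G\<rparr>"

text \<open>Linear independence of a family, so in particular the members are pairwise distinct.\<close>

definition rat_independent_family :: "('i \<Rightarrow> real) \<Rightarrow> 'i set \<Rightarrow> bool" where
  "rat_independent_family f I \<longleftrightarrow>
     inj_on f I \<and> module.independent (\<lambda>(q::rat) (x::real). of_rat q * x) (f ` I)"

definition count_solutions :: "real \<Rightarrow> 'i set \<Rightarrow> ('i \<Rightarrow> real) \<Rightarrow> real \<Rightarrow> nat" where
  "count_solutions b I a T =
     card {n \<in> I \<rightarrow>\<^sub>E {1::nat..}. b + (\<Sum>i\<in>I. real (n i) * a i) \<le> T}"

text \<open>
  Points of the metric graph: \<open>Interior e x\<close> is the point of the arc \<open>e\<close> that is reached at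
  time \<open>x\<close> after leaving the tail of \<open>e\<close>, with \<open>0 < x < t e\<close>. The ends of all arcs at a vertex
  are identified with the single point \<open>Vertex v\<close>.
\<close>

datatype ('a, 'b) graph_point = Vertex 'a | Interior 'b real

definition occupied_verts ::
  "('a, 'b) pre_digraph \<Rightarrow> ('b \<Rightarrow> real) \<Rightarrow> 'a \<Rightarrow> real \<Rightarrow> 'a set" where
  "occupied_verts G t s T =
     {v. \<exists>p. pre_digraph.awalk G s p v \<and> wf_digraph.awalk_cost t p = T}"

definition endpoints ::
  "('a, 'b) pre_digraph \<Rightarrow> ('b \<Rightarrow> real) \<Rightarrow> 'a \<Rightarrow> real \<Rightarrow> ('a, 'b) graph_point set" where
  "endpoints G t s T =
     Vertex ` occupied_verts G t s T \<union>
     {Interior e x |e x. e \<in> arcs G \<and> 0 < x \<and> x < t e \<and>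
        tail G e \<in> occupied_verts G t s (T - x)}"

definition num_endpoints ::
  "('a, 'b) pre_digraph \<Rightarrow> ('b \<Rightarrow> real) \<Rightarrow> 'a \<Rightarrow> real \<Rightarrow> nat" where
  "num_endpoints G t s T = card (endpoints G t s T)"

end

theory Submission
  imports Defs
begin

text \<open>
  Every elementary cycle consists of the chain to the tail of an arc \<open>e\<close> entering the source, followed
  by \<open>e\<close>. A walk from the source hence splits into elementary cycles and a final chain, so \<open>v\<close> is
  occupied exactly at the times \<open>t(l\<^sub>v) + \<Sum> n\<^sub>i t(c\<^sub>i)\<close> with \<open>n\<^sub>i \<ge> 0\<close>; for fixed \<open>v\<close> independence
  of the cycle times makes these times pairwise distinct. Write \<open>M(b)\<close> for the number of tuples
  \<open>n\<close> with \<open>b + \<Sum> n\<^sub>i t(c\<^sub>i) \<le> T\<close>. The interior of an arc \<open>e\<close> from \<open>u\<close> contains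
  \<open>M(t(l\<^sub>u)) - M(t(l\<^sub>u) + t(e))\<close> endpoints, up to one that sits at \<open>u\<close> itself at time \<open>T\<close>.
  Summing over the arcs, the first terms give the out-degrees. In the second terms \<open>t(l\<^sub>u) + t(e)\<close> is
  \<open>t(l\<^sub>v)\<close> for the unique arc into \<open>v \<noteq> s\<close>, and \<open>t(c\<^sub>i)\<close> for the \<open>i\<close>-th arc into \<open>s\<close>, which counts the
  tuples with \<open>n\<^sub>i \<noteq> 0\<close>; grouping the tuples by their support \<open>I\<close> gives the in-degrees of \<open>G'(v, I)\<close>.
  An occupied vertex \<open>v\<close> is counted once as an endpoint but \<open>\<rho>\<^sub>o\<^sub>u\<^sub>t(v)\<close> times by the formula, which agrees
  if \<open>\<rho>\<^sub>o\<^sub>u\<^sub>t(v) = 1\<close>; immediately after \<open>T\<close> no vertex is occupied.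
\<close>

section \<open>Linear inequalities in natural numbers\<close>

text \<open>Unlike in \<open>count_solutions\<close>, coordinates may be 0. Functions are
  extensional on \<open>K\<close>, so that every tuple is represented exactly once.\<close>

definition solutions :: "real \<Rightarrow> 'i set \<Rightarrow> ('i \<Rightarrow> real) \<Rightarrow> real \<Rightarrow> ('i \<Rightarrow> nat) set" where
  "solutions b K a T = {n \<in> K \<rightarrow>\<^sub>E UNIV. b + (\<Sum>i\<in>K. real (n i) * a i) \<le> T}"

lemma finite_solutions:
  assumes K: "finite K" and a: "\<And>i. i \<in> K \<Longrightarrow> 0 < a i"
  shows "finite (solutions b K a T)"
proof -
  have "n i \<le> nat \<lfloor>(T - b) / a i\<rfloor>" if n: "n \<in> solutions b K a T" and i: "i \<in> K" for n i
  proof -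
    have "real (n i) * a i \<le> (\<Sum>j\<in>K. real (n j) * a j)"
      using K i by (intro member_le_sum) (auto intro: mult_nonneg_nonneg less_imp_le[OF a])
    also have "\<dots> \<le> T - b"
      using n by (simp add: solutions_def)
    finally have "real (n i) \<le> (T - b) / a i"
      using a[OF i] by (simp add: pos_le_divide_eq)
    then show ?thesis by linarith
  qed
  then have "solutions b K a T \<subseteq> (\<Pi>\<^sub>E i\<in>K. {..nat \<lfloor>(T - b) / a i\<rfloor>})"
    by (fastforce simp: solutions_def intro!: PiE_I)
  then show ?thesis
    by (rule finite_subset) (intro finite_PiE K, auto)
qed

text \<open>Restriction to the support \<open>I\<close> is a bijection onto the positive tuples over
  \<open>I\<close>; its inverse fills in zeros on \<open>K - I\<close>.\<close>

lemma card_solutions_support: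
  assumes K: "finite K" and I: "I \<subseteq> K"
  shows "card {n \<in> solutions b K a T. {i \<in> K. n i \<noteq> 0} = I} = count_solutions b I a T"
proof -
  let ?A = "{n \<in> solutions b K a T. {i \<in> K. n i \<noteq> 0} = I}"
  let ?B = "{n \<in> I \<rightarrow>\<^sub>E {1::nat..}. b + (\<Sum>i\<in>I. real (n i) * a i) \<le> T}"
  \<comment> \<open>The value \<open>undefined\<close> outside \<open>K\<close> keeps the extension
    extensional.\<close>
  let ?ext = "\<lambda>n i. if i \<in> I then n i else if i \<in> K then 0 else undefined"
  have sum_eq: "(\<Sum>i\<in>K. real (n i) * a i) = (\<Sum>i\<in>I. real (n i) * a i)"
    if "\<And>i. i \<in> K - I \<Longrightarrow> n i = 0" for n :: "_ \<Rightarrow> nat"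
    using K I that by (intro sum.mono_neutral_right) auto
  have "bij_betw (\<lambda>n. restrict n I) ?A ?B"
  proof (rule bij_betw_byWitness[where f' = ?ext])
    show "\<forall>n\<in>?A. ?ext (restrict n I) = n"
      by (auto simp: solutions_def fun_eq_iff PiE_iff extensional_def)
    show "\<forall>n\<in>?B. restrict (?ext n) I = n"
      using I by (auto simp: fun_eq_iff PiE_iff extensional_def)
    show "(\<lambda>n. restrict n I) ` ?A \<subseteq> ?B"
    proof clarify
      fix n assume n: "n \<in> solutions b K a T" and IK: "I = {i \<in> K. n i \<noteq> 0}"
      have "(\<Sum>i\<in>I. real (restrict n I i) * a i) = (\<Sum>i\<in>K. real (n i) * a i)"
        using IK by (subst sum_eq) auto
      moreover have "restrict n I \<in> I \<rightarrow>\<^sub>E {1..}"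
        using IK by (auto simp: Suc_le_eq)
      ultimately show "restrict n {i \<in> K. n i \<noteq> 0} \<in> {i \<in> K. n i \<noteq> 0} \<rightarrow>\<^sub>E {1..} \<and>
          b + (\<Sum>i\<in>{i \<in> K. n i \<noteq> 0}. real (restrict n {i \<in> K. n i \<noteq> 0} i) * a i) \<le> T"
        using n unfolding IK[symmetric] by (auto simp: solutions_def)
    qed
    show "?ext ` ?B \<subseteq> ?A"
    proof clarify
      fix n assume n: "n \<in> I \<rightarrow>\<^sub>E {1::nat..}" and le: "b + (\<Sum>i\<in>I. real (n i) * a i) \<le> T"
      have "(\<Sum>i\<in>K. real (?ext n i) * a i) = (\<Sum>i\<in>I. real (n i) * a i)"
        by (subst sum_eq) auto
      moreover have "?ext n \<in> K \<rightarrow>\<^sub>E UNIV" using I by (auto simp: PiE_iff extensional_def)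
      moreover have "{i \<in> K. ?ext n i \<noteq> 0} = I"
        using n I by (fastforce simp: PiE_iff)
      ultimately show "?ext n \<in> solutions b K a T \<and> {i \<in> K. ?ext n i \<noteq> 0} = I"
        using le unfolding solutions_def by simp
    qed
  qed
  then show ?thesis
    unfolding count_solutions_def by (rule bij_betw_same_card)
qed

text \<open>Grouping tuples by support trades the sum over subsets in the formula for a sum over
  tuples. The weights \<open>w\<close> will be degrees, which depend on the support only.\<close>

lemma sum_solutions_support:
  fixes w :: "'i set \<Rightarrow> int"
  assumes K: "finite K" and a: "\<And>i. i \<in> K \<Longrightarrow> 0 < a i"
  shows "(\<Sum>n\<in>solutions b K a T. w {i \<in> K. n i \<noteq> 0})
    = (\<Sum>I\<in>Pow K. w I * int (count_solutions b I a T))"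
proof -
  let ?S = "solutions b K a T" and ?supp = "\<lambda>n::_ \<Rightarrow> nat. {i \<in> K. n i \<noteq> 0}"
  have "(\<Sum>n\<in>?S. w (?supp n)) = (\<Sum>I\<in>Pow K. \<Sum>n\<in>{n \<in> ?S. ?supp n = I}. w (?supp n))"
    using finite_solutions[OF K a] K by (intro sum.group[symmetric]) auto
  also have "\<dots> = (\<Sum>I\<in>Pow K. w I * int (card {n \<in> ?S. ?supp n = I}))"
    by (intro sum.cong) auto
  also have "\<dots> = (\<Sum>I\<in>Pow K. w I * int (count_solutions b I a T))"
    by (intro sum.cong refl) (simp only: card_solutions_support[OF K] Pow_iff)
  finally show ?thesis .
qed

lemma sum_fun_upd_shift:
  fixes n :: "'i \<Rightarrow> nat"
  assumes "finite K" "i \<in> K"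
  shows "(\<Sum>j\<in>K. real ((n(i := m)) j) * a j) = (\<Sum>j\<in>K. real (n j) * a j) + (real m - real (n i)) * a i"
  using assms by (simp add: sum.remove[where x = i] algebra_simps)

text \<open>Lowering coordinate \<open>i\<close> by one moves one copy of \<open>a i\<close> into
  the constant term, and this is reversible.\<close>

lemma card_solutions_pos:
  assumes K: "finite K" and i: "i \<in> K"
  shows "card {n \<in> solutions b K a T. n i \<noteq> 0} = card (solutions (b + a i) K a T)"
proof -
  have "bij_betw (\<lambda>n. n(i := n i - 1)) {n \<in> solutions b K a T. n i \<noteq> 0} (solutions (b + a i) K a T)"
  proof (rule bij_betw_byWitness[where f' = "\<lambda>n. n(i := Suc (n i))"])
    show "(\<lambda>n. n(i := n i - 1)) ` {n \<in> solutions b K a T. n i \<noteq> 0} \<subseteq> solutions (b + a i) K a T"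
    proof clarify
      fix n assume n: "n \<in> solutions b K a T" "0 < n i"
      then show "n(i := n i - 1) \<in> solutions (b + a i) K a T"
        using i unfolding solutions_def mem_Collect_eq sum_fun_upd_shift[OF K i]
        by (auto simp: PiE_iff extensional_def of_nat_diff algebra_simps)
    qed
    show "(\<lambda>n. n(i := Suc (n i))) ` solutions (b + a i) K a T \<subseteq> {n \<in> solutions b K a T. n i \<noteq> 0}"
    proof clarify
      fix n assume n: "n \<in> solutions (b + a i) K a T"
      then show "n(i := Suc (n i)) \<in> solutions b K a T \<and> (n(i := Suc (n i))) i \<noteq> 0"
        using i unfolding solutions_def mem_Collect_eq sum_fun_upd_shift[OF K i]
        by (auto simp: PiE_iff extensional_def algebra_simps)
    qed
  qed auto
  then show ?thesis by (rule bij_betw_same_card)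
qed

text \<open>Double counting of the pairs of a tuple \<open>n\<close> and an index \<open>i\<close>
  with \<open>n i \<noteq> 0\<close>.\<close>

lemma sum_card_support_solutions:
  assumes K: "finite K" and a: "\<And>i. i \<in> K \<Longrightarrow> 0 < a i"
  shows "(\<Sum>n\<in>solutions b K a T. card {i \<in> K. n i \<noteq> 0}) = (\<Sum>i\<in>K. card (solutions (b + a i) K a T))"
proof -
  have "(\<Sum>n\<in>solutions b K a T. card {i \<in> K. n i \<noteq> 0})
      = (\<Sum>i\<in>K. card {n \<in> solutions b K a T. n i \<noteq> 0})"
    by (rule sum_multicount_gen) (auto simp: K finite_solutions[OF K a])
  also have "\<dots> = (\<Sum>i\<in>K. card (solutions (b + a i) K a T))"
    by (intro sum.cong refl card_solutions_pos[OF K])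
  finally show ?thesis .
qed

text \<open>Finitely many tuples have a value in the interval from \<open>T\<close> to
  \<open>T + 1\<close>, so no new tuple appears before the least value above
  \<open>T\<close>.\<close>

lemma eventually_solutions_at_right:
  assumes K: "finite K" and a: "\<And>i. i \<in> K \<Longrightarrow> 0 < a i"
  shows "\<forall>\<^sub>F T' in at_right T. solutions b K a T' = solutions b K a T"
proof -
  \<comment> \<open>The cutoff \<open>T + 1\<close> serves only to make the set of values above
    \<open>T\<close> finite.\<close>
  define V where "V = (\<lambda>n. b + (\<Sum>i\<in>K. real (n i) * a i)) ` solutions b K a (T + 1) \<inter> {T<..}"
  have "\<forall>\<^sub>F T' in at_right T. \<forall>x\<in>V. T' < x"
    unfolding V_def using finite_solutions[OF K a]
    by (intro eventually_ball_finite ballI) (auto simp: eventually_at_right_less intro: eventually_at_right_less order_tendstoD)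
  moreover have "\<forall>\<^sub>F T' in at_right T. T < T' \<and> T' < T + 1"
    by (auto simp: eventually_at_right[of T "T + 1"] intro: exI[of _ "T + 1"])
  ultimately show ?thesis
  proof eventually_elim
    case (elim T')
    have "n \<in> solutions b K a T" if "n \<in> solutions b K a T'" for n
    proof (rule ccontr)
      assume "n \<notin> solutions b K a T"
      then have "b + (\<Sum>i\<in>K. real (n i) * a i) \<in> V"
        using that elim unfolding V_def by (auto simp: solutions_def)
      with elim that show False by (auto simp: solutions_def)
    qed
    then show ?case using elim by (auto simp: solutions_def)
  qed
qed

section \<open>Independence over the rationals\<close>

text \<open>Two tuples with the same value yield a rational relation with coefficients
  \<open>n i - m i\<close>, all of which must vanish.\<close>

lemma rat_independent_family_inj:
  fixes f :: "'i \<Rightarrow> real"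
  assumes f: "rat_independent_family f K" and K: "finite K"
  shows "inj_on (\<lambda>n. \<Sum>i\<in>K. real (n i) * f i) (K \<rightarrow>\<^sub>E (UNIV :: nat set))"
proof (rule inj_onI)
  interpret rat: vector_space "\<lambda>(q::rat) (x::real). of_rat q * x"
    by unfold_locales (auto simp: algebra_simps of_rat_add of_rat_mult)
  have inj: "inj_on f K" and indep: "rat.independent (f ` K)"
    using f by (auto simp: rat_independent_family_def)
  fix n m :: "'i \<Rightarrow> nat"
  assume nm: "n \<in> K \<rightarrow>\<^sub>E UNIV" "m \<in> K \<rightarrow>\<^sub>E UNIV"
    and eq: "(\<Sum>i\<in>K. real (n i) * f i) = (\<Sum>i\<in>K. real (m i) * f i)"
  \<comment> \<open>Independence speaks about the set of values of \<open>f\<close>, so the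
    coefficients are indexed by values instead of indices.\<close>
  define u where "u x = (of_nat (n (inv_into K f x)) - of_nat (m (inv_into K f x)) :: rat)" for x
  have "(\<Sum>x\<in>f ` K. of_rat (u x) * x) = (\<Sum>i\<in>K. real (n i) * f i - real (m i) * f i)"
    unfolding sum.reindex[OF inj] by (auto intro!: sum.cong simp: u_def inj of_rat_diff algebra_simps)
  also have "\<dots> = 0" using eq by (simp add: sum_subtractf)
  finally have "u (f i) = 0" if "i \<in> K" for i
    using rat.independentD[OF indep, of "f ` K" u "f i"] K that by auto
  then have "n i = m i" if "i \<in> K" for i
    using that by (auto simp: u_def inj)
  then show "n = m" using nm by (auto intro: PiE_ext)
qed

lemma rat_independent_family_reindex_subset:
  assumes "rat_independent_family f J" "inj_on h I" "h ` I \<subseteq> J"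
  shows "rat_independent_family (f \<circ> h) I"
proof -
  interpret rat: vector_space "\<lambda>(q::rat) (x::real). of_rat q * x"
    by unfold_locales (auto simp: algebra_simps of_rat_add of_rat_mult)
  have f: "inj_on f J" "rat.independent (f ` J)"
    using assms(1) by (auto simp: rat_independent_family_def)
  have "rat.independent (f ` h ` I)"
    using rat.independent_mono[OF f(2) image_mono[OF assms(3)]] .
  moreover have "inj_on (f \<circ> h) I"
    using assms(2) inj_on_subset[OF f(1) assms(3)] by (rule comp_inj_on)
  ultimately show ?thesis by (simp add: rat_independent_family_def image_comp)
qed

section \<open>Chains and cycles of a one-way Sperner graph\<close>

lemma awalk_delete_arcs:
  "pre_digraph.awalk (G\<lparr>arcs := arcs G - B\<rparr>) u p v \<longleftrightarrow> pre_digraph.awalk G u p v \<and> set p \<inter> B = {}"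
proof -
  have "pre_digraph.cas (G\<lparr>arcs := arcs G - B\<rparr>) u p v = pre_digraph.cas G u p v"
    by (induction p arbitrary: u) (auto simp: pre_digraph.cas.simps)
  then show ?thesis by (auto simp: pre_digraph.awalk_def)
qed

locale sperner_digraph = fin_digraph G for G :: "('a, 'b) pre_digraph" (structure) +
  fixes s :: 'a
  assumes sperner: "one_way_sperner G s"
begin

abbreviation back_arcs :: "'b set" where "back_arcs \<equiv> in_arcs G s"
abbreviation chain :: "'a \<Rightarrow> 'b list" where "chain \<equiv> simple_chain G s"
text \<open>Meant for \<open>e\<close> entering the source: the chain to the tail of
  \<open>e\<close>, closed up by \<open>e\<close>.\<close>

abbreviation cycle_of :: "'b \<Rightarrow> 'b set" where "cycle_of e \<equiv> insert e (set (chain (tail G e)))"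

lemma source_in_verts: "s \<in> verts G"
  using sperner by (auto simp: one_way_sperner_def out_tree_def)

text \<open>The set \<open>B\<close> of added arcs must consist of all arcs into \<open>s\<close>:
  one left in the tree would close a second tree walk from \<open>s\<close> to \<open>s\<close>,
  besides the empty one.\<close>

lemma ex1_tree_walk:
  assumes "v \<in> verts G"
  shows "\<exists>!p. awalk s p v \<and> set p \<inter> back_arcs = {}"
proof -
  obtain B where B: "B \<subseteq> back_arcs" and ot: "out_tree (G\<lparr>arcs := arcs G - B\<rparr>) s"
    using sperner unfolding one_way_sperner_def by blast
  have ex1: "\<exists>!p. awalk s p v \<and> set p \<inter> B = {}" if "v \<in> verts G" for v
    using ot that by (auto simp: out_tree_def awalk_delete_arcs)
  have "e \<in> B" if e: "e \<in> back_arcs" for e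
  proof (rule ccontr)
    assume "e \<notin> B"
    obtain p where p: "awalk s p (tail G e)" "set p \<inter> B = {}"
      using ex1[of "tail G e"] e by (auto simp: in_arcs_def)
    have "awalk s (p @ [e]) s"
      using p e by (intro awalk_appendI[OF p(1)]) (auto simp: awalk_simps in_arcs_def)
    moreover have "set (p @ [e]) \<inter> B = {}" using p \<open>e \<notin> B\<close> by auto
    moreover have "awalk s [] s" "set [] \<inter> B = {}"
      using source_in_verts by (auto simp: awalk_Nil_iff)
    ultimately show False using ex1[OF source_in_verts] by blast
  qed
  then show ?thesis using ex1[OF assms] B by (metis subsetI subset_antisym)
qed

text \<open>A path from \<open>s\<close> never enters \<open>s\<close> again. Conversely, shortening
  a tree walk to a path gives a tree walk to the same vertex, which by uniqueness is the original
  one.\<close>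

lemma apath_from_source_iff:
  assumes "v \<in> verts G"
  shows "apath s p v \<longleftrightarrow> awalk s p v \<and> set p \<inter> back_arcs = {}"
proof
  assume ap: "apath s p v"
  \<comment> \<open>The vertices visited after \<open>s\<close> are the heads of the arcs, so no arc
    of \<open>p\<close> has head \<open>s\<close>.\<close>
  then have "distinct (s # map (head G) p)"
    using awalk_verts_conv'[of s p v] by (cases p) (auto simp: apath_def awalk_def)
  then show "awalk s p v \<and> set p \<inter> back_arcs = {}"
    using ap by (auto simp: apath_def in_arcs_def)
next
  assume p: "awalk s p v \<and> set p \<inter> back_arcs = {}"
  let ?q = "awalk_to_apath p"
  have q: "apath s ?q v" using p by (auto intro: apath_awalk_to_apath)
  moreover have "set ?q \<inter> back_arcs = {}"
    using p awalk_to_apath_subset[of s p v] by blast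
  ultimately have "?q = p" using ex1_tree_walk[OF assms] p by (auto simp: apath_def)
  with q show "apath s p v" by simp
qed

lemma
  assumes "v \<in> verts G"
  shows awalk_chain: "awalk s (chain v) v"
    and chain_back_arcs: "set (chain v) \<inter> back_arcs = {}"
    and distinct_chain: "distinct (awalk_verts s (chain v))"
    and chain_unique: "awalk s p v \<Longrightarrow> set p \<inter> back_arcs = {} \<Longrightarrow> p = chain v"
proof -
  have ch: "apath s (chain v) v"
    unfolding simple_chain_def apath_from_source_iff[OF assms] by (rule theI'[OF ex1_tree_walk[OF assms]])
  then show c: "awalk s (chain v) v" "set (chain v) \<inter> back_arcs = {}"
    using apath_from_source_iff[OF assms] by auto
  show "distinct (awalk_verts s (chain v))" using ch by (simp add: apath_def)
  show "p = chain v" if "awalk s p v" "set p \<inter> back_arcs = {}"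
    using ex1_tree_walk[OF assms] c that by blast
qed

lemma chain_source: "chain s = []"
  using chain_unique[OF source_in_verts, of "[]"] source_in_verts by (simp add: awalk_Nil_iff)

text \<open>Appending an arc that does not enter \<open>s\<close> to a chain gives a tree walk
  again, and tree walks are unique.\<close>

lemma chain_head:
  assumes "e \<in> arcs G - back_arcs"
  shows "chain (head G e) = chain (tail G e) @ [e]"
proof -
  have "awalk s (chain (tail G e) @ [e]) (head G e)"
    using assms by (intro awalk_appendI[OF awalk_chain]) (auto simp: awalk_simps)
  then show ?thesis
    using assms chain_back_arcs[of "tail G e"]
    by (intro chain_unique[symmetric]) auto
qed

text \<open>The only arc into a vertex other than \<open>s\<close> is the last arc of its
  chain.\<close>

lemma bij_betw_head: "bij_betw (head G) (arcs G - back_arcs) (verts G - {s})"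
proof (rule bij_betwI')
  fix e f assume "e \<in> arcs G - back_arcs" "f \<in> arcs G - back_arcs"
  then show "(head G e = head G f) = (e = f)"
    using chain_head by (metis last_snoc)
next
  fix e assume "e \<in> arcs G - back_arcs"
  then show "head G e \<in> verts G - {s}" by (auto simp: in_arcs_def)
next
  fix v assume v: "v \<in> verts G - {s}"
  then have "chain v \<noteq> []" using awalk_chain[of v] by (auto simp: awalk_Nil_iff)
  then obtain p e where pe: "chain v = p @ [e]" by (metis rev_exhaust)
  then have "e \<in> arcs G - back_arcs" "head G e = v"
    using awalk_chain[of v] chain_back_arcs[of v] v by (auto simp: awalk_simps)
  then show "\<exists>e\<in>arcs G - back_arcs. v = head G e" by blast
qed

lemma in_arcs_chain:
  assumes v: "v \<in> verts G - {s}"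
  shows "{e \<in> arcs G. head G e = v} \<subseteq> set (chain v)"
proof clarify
  fix e assume "e \<in> arcs G" "v = head G e"
  then show "e \<in> set (chain (head G e))"
    using v by (subst chain_head) (auto simp: in_arcs_def)
qed

lemma cycle_of_back_arcs: "e \<in> back_arcs \<Longrightarrow> cycle_of e \<inter> back_arcs = {e}"
  using chain_back_arcs[of "tail G e"] by (auto simp: in_arcs_def)

lemma cycle_of_subset: "e \<in> back_arcs \<Longrightarrow> cycle_of e \<subseteq> arcs G"
  using awalk_chain[of "tail G e"] by (auto simp: in_arcs_def)

text \<open>A closed walk inside the tree could be appended to the chain to \<open>u\<close>, giving
  a second tree walk to \<open>u\<close>.\<close>

lemma cycle_through_back_arc:
  assumes p: "awalk u p u" "distinct (tl (awalk_verts u p))" "p \<noteq> []"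
  shows "set p \<inter> back_arcs \<noteq> {}"
proof
  assume p_tree: "set p \<inter> back_arcs = {}"
  have u: "u \<in> verts G" using p(1) by auto
  have "awalk s (chain u @ p) u" using awalk_appendI[OF awalk_chain[OF u] p(1)] .
  moreover have "set (chain u @ p) \<inter> back_arcs = {}" using chain_back_arcs[OF u] p_tree by auto
  ultimately have "chain u @ p = chain u" using chain_unique[OF u] by blast
  with p(3) show False by simp
qed

text \<open>A cycle contains an arc \<open>e\<close> into \<open>s\<close>. Rotated to start at
  \<open>s\<close>, it is a tree walk to the tail of \<open>e\<close> followed by \<open>e\<close>,
  and this tree walk is the chain.\<close>

lemma elem_cycles_eq: "elem_cycles G = cycle_of ` back_arcs"
proof (intro equalityI subsetI)
  fix C assume "C \<in> elem_cycles G"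
  then obtain p u where C: "C = set p"
    and p: "awalk u p u" "distinct (tl (awalk_verts u p))" "p \<noteq> []"
    by (auto simp: elem_cycles_def cycle_def)
  obtain e where e: "e \<in> set p" "e \<in> back_arcs" using cycle_through_back_arc[OF p] by blast
  then obtain q r where qr: "p = q @ e # r" by (meson split_list)
  have he: "head G e = s" using e by (auto simp: in_arcs_def)
  have "awalk u q (tail G e)" "awalk s r u"
    using p(1) by (auto simp: qr awalk_simps he)
  then have rq: "awalk s (r @ q) (tail G e)" by (intro awalk_appendI)
  \<comment> \<open>A cycle enters each of its vertices once, so \<open>e\<close> is its only arc
    into \<open>s\<close>.\<close>
  have "distinct (map (head G) p)"
    using p awalk_verts_conv'[of u p u] by (simp add: awalk_def)
  then have "set (r @ q) \<inter> back_arcs = {}"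
    by (auto simp: qr he in_arcs_def image_iff)
  then have "r @ q = chain (tail G e)"
    using rq e by (intro chain_unique) (auto simp: in_arcs_def)
  then have "C = cycle_of e"
    by (metis C qr set_append list.simps(15) Un_commute Un_insert_left)
  then show "C \<in> cycle_of ` back_arcs" using e by blast
next
  fix C assume "C \<in> cycle_of ` back_arcs"
  then obtain e where e: "e \<in> back_arcs" and C: "C = cycle_of e" by blast
  then have v: "tail G e \<in> verts G" and he: "head G e = s" "e \<in> arcs G" by (auto simp: in_arcs_def)
  let ?p = "e # chain (tail G e)"
  have "awalk (tail G e) ?p (tail G e)"
    using he awalk_chain[OF v] by (simp add: awalk_Cons_iff)
  moreover have "distinct (tl (awalk_verts (tail G e) ?p))"
    using distinct_chain[OF v] by (simp add: he)
  ultimately have "cycle ?p" unfolding cycle_def by blast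
  then show "C \<in> elem_cycles G" unfolding elem_cycles_def C by (metis (mono_tags, lifting) mem_Collect_eq list.simps(15))
qed

text \<open>The arc \<open>e\<close> is recovered as the only arc of its cycle that enters
  \<open>s\<close>.\<close>

lemma inj_on_cycle_of: "inj_on cycle_of back_arcs"
  by (rule inj_onI) (metis cycle_of_back_arcs the_elem_eq)

text \<open>The chain repeats no arc and avoids \<open>e\<close>, so the sum over the arc set is the
  passage time of the closed walk.\<close>

lemma sum_cycle_of:
  assumes "e \<in> back_arcs"
  shows "sum t (cycle_of e) = awalk_cost t (chain (tail G e)) + t e"
proof -
  have v: "tail G e \<in> verts G" using assms by (auto simp: in_arcs_def)
  have "distinct (chain (tail G e))"
    using distinct_verts_imp_distinct[OF awalk_chain[OF v] distinct_chain[OF v]] .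
  moreover have "e \<notin> set (chain (tail G e))" using chain_back_arcs[OF v] assms by blast
  ultimately show ?thesis by (simp add: awalk_cost_def sum_list_distinct_conv_sum_set)
qed

end

section \<open>Times at which a vertex is occupied\<close>

locale sperner_metric_graph = sperner_digraph +
  fixes t :: "'b \<Rightarrow> real" and k :: nat and c :: "nat \<Rightarrow> 'b set"
  assumes t_pos: "e \<in> arcs G \<Longrightarrow> 0 < t e"
    and bij_c: "bij_betw c {1..k} (elem_cycles G)"
    and independent_cycles: "rat_independent_family (\<lambda>i. sum t (c i)) {1..k}"
begin

text \<open>The arc by which the cycle \<open>c i\<close> returns to \<open>s\<close>. It carries
  the numbering of the cycles over to the arcs into \<open>s\<close>.\<close>

definition ret ::  "nat \<Rightarrow> 'b" where "ret i = inv_into back_arcs cycle_of (c i)"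

abbreviation sols :: "real \<Rightarrow> real \<Rightarrow> (nat \<Rightarrow> nat) set" where
  "sols b T \<equiv> solutions b {1..k} (\<lambda>i. sum t (c i)) T"

abbreviation chain_time :: "'a \<Rightarrow> real" where "chain_time v \<equiv> awalk_cost t (chain v)"

abbreviation cycles_time :: "(nat \<Rightarrow> nat) \<Rightarrow> real" where
  "cycles_time n \<equiv> \<Sum>i\<in>{1..k}. real (n i) * sum t (c i)"

lemma bij_betw_ret: "bij_betw ret {1..k} back_arcs"
proof -
  have "bij_betw (inv_into back_arcs cycle_of) (elem_cycles G) back_arcs"
    using inj_on_cycle_of by (simp add: elem_cycles_eq bij_betw_inv_into inj_on_imp_bij_betw)
  from bij_betw_trans[OF bij_c this] show ?thesis by (simp add: ret_def[abs_def] comp_def)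
qed

lemma ret_in_back_arcs: "i \<in> {1..k} \<Longrightarrow> ret i \<in> back_arcs"
  using bij_betw_apply[OF bij_betw_ret] .

lemma cycle_of_ret:
  assumes "i \<in> {1..k}"
  shows "cycle_of (ret i) = c i"
proof -
  have "c i \<in> cycle_of ` back_arcs" using bij_betw_apply[OF bij_c assms] by (simp add: elem_cycles_eq)
  then show ?thesis unfolding ret_def by (rule f_inv_into_f)
qed

lemma cycle_time: "i \<in> {1..k} \<Longrightarrow> sum t (c i) = chain_time (tail G (ret i)) + t (ret i)"
  using sum_cycle_of[OF ret_in_back_arcs] cycle_of_ret by metis

lemma cycle_subset: "i \<in> {1..k} \<Longrightarrow> c i \<subseteq> arcs G"
  using cycle_of_subset[OF ret_in_back_arcs] by (simp only: cycle_of_ret)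

lemma cycle_back_arcs: "i \<in> {1..k} \<Longrightarrow> c i \<inter> back_arcs = {ret i}"
  using cycle_of_back_arcs[OF ret_in_back_arcs] by (simp only: cycle_of_ret)

lemma cycle_time_pos:
  assumes i: "i \<in> {1..k}"
  shows "0 < sum t (c i)"
proof -
  have "c i \<subseteq> arcs G" "c i \<noteq> {}"
    using cycle_subset[OF i] cycle_back_arcs[OF i] by auto
  then show ?thesis
    by (intro sum_pos) (auto intro: finite_subset t_pos)
qed

lemma finite_sols: "finite (sols b T)"
  by (intro finite_solutions finite_atLeastAtMost cycle_time_pos)

lemma inj_on_cycles_time: "inj_on cycles_time ({1..k} \<rightarrow>\<^sub>E UNIV)"
  by (rule rat_independent_family_inj[OF independent_cycles]) simp

text \<open>All elementary cycles pass through \<open>s\<close>, so they can be concatenated there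
  freely: the times of closed walks at \<open>s\<close> contain 0 and every cycle time and are
  closed under addition.\<close>

lemma closed_walk_times: "\<exists>p. awalk s p s \<and> awalk_cost t p = cycles_time n"
proof -
  let ?Z = "{awalk_cost t p |p. awalk s p s}"
  have zero: "0 \<in> ?Z"
    using source_in_verts by (auto simp: awalk_Nil_iff intro!: exI[of _ "[]"])
  have add: "x + y \<in> ?Z" if xy: "x \<in> ?Z" "y \<in> ?Z" for x y
  proof -
    obtain p q where "awalk s p s" "awalk s q s" "x = awalk_cost t p" "y = awalk_cost t q"
      using xy unfolding mem_Collect_eq by blast
    then show ?thesis
      using awalk_appendI[of s p s q s] by (intro CollectI exI[of _ "p @ q"]) auto
  qed
  have cycle: "sum t (c i) \<in> ?Z" if i: "i \<in> {1..k}" for i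
  proof -
    have e: "tail G (ret i) \<in> verts G" "head G (ret i) = s" "ret i \<in> arcs G"
      using ret_in_back_arcs[OF i] by (auto simp: in_arcs_def)
    have "awalk s (chain (tail G (ret i)) @ [ret i]) s"
      using e source_in_verts by (intro awalk_appendI[OF awalk_chain]) (auto simp: awalk_simps)
    then show ?thesis
      using cycle_time[OF i] by (intro CollectI exI[of _ "chain (tail G (ret i)) @ [ret i]"]) auto
  qed
  have mult: "real m * x \<in> ?Z" if "x \<in> ?Z" for m x
    by (induction m) (use zero add that in \<open>auto simp: distrib_right simp del: mem_Collect_eq\<close>)
  have "(\<Sum>i\<in>I. real (n i) * sum t (c i)) \<in> ?Z" if "finite I" "I \<subseteq> {1..k}" for I
    using that by (induction I) (use zero add mult cycle in \<open>auto simp del: mem_Collect_eq atLeastAtMost_iff\<close>)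
  from this[of "{1..k}"] show ?thesis by auto
qed

text \<open>Induction on the last arc. A tree arc prolongs the current chain; the arc
  \<open>ret i\<close> completes the cycle \<open>c i\<close>, which raises \<open>n i\<close> by
  one and resets the chain to the empty one.\<close>

lemma walk_time:
  assumes "awalk s p v"
  shows "\<exists>n\<in>{1..k} \<rightarrow>\<^sub>E UNIV. awalk_cost t p = chain_time v + cycles_time n"
  using assms
proof (induction p arbitrary: v rule: rev_induct)
  case Nil
  then have "v = s" by (simp add: awalk_Nil_iff)
  then show ?case
    by (intro bexI[of _ "\<lambda>i\<in>{1..k}. 0"]) (auto simp: chain_source)
next
  case (snoc e p)
  then have p: "awalk s p (tail G e)" and e: "e \<in> arcs G" "head G e = v"
    by (auto simp: awalk_simps)
  obtain n where n: "n \<in> {1..k} \<rightarrow>\<^sub>E UNIV" "awalk_cost t p = chain_time (tail G e) + cycles_time n"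
    using snoc.IH[OF p] by blast
  show ?case
  proof (cases "e \<in> back_arcs")
    case False
    then have "chain_time v = chain_time (tail G e) + t e"
      using chain_head[of e] e by auto
    with n show ?thesis by (intro bexI[of _ n]) auto
  next
    case True
    then have "e \<in> ret ` {1..k}" by (simp only: bij_betw_imp_surj_on[OF bij_betw_ret])
    then obtain i where i: "i \<in> {1..k}" "ret i = e" by blast
    have v: "v = s" using True e by (auto simp: in_arcs_def)
    let ?n = "n(i := Suc (n i))"
    have "cycles_time ?n = cycles_time n + sum t (c i)"
      using sum_fun_upd_shift[OF finite_atLeastAtMost i(1), of n "Suc (n i)" "\<lambda>i. sum t (c i)"]
      by (simp only: of_nat_Suc add_diff_cancel_right' mult_1)
    then have "awalk_cost t (p @ [e]) = chain_time v + cycles_time ?n"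
      using cycle_time[OF i(1)] n(2) i(2)
      by (simp only: v chain_source awalk_cost_append awalk_cost_Cons awalk_cost_Nil)
    moreover have "?n \<in> {1..k} \<rightarrow>\<^sub>E UNIV"
      using n(1) i(1) by (auto simp: PiE_iff extensional_def)
    ultimately show ?thesis by blast
  qed
qed

text \<open>For the converse of \<open>walk_time\<close>, run through the cycles at \<open>s\<close>
  first and follow the chain to \<open>v\<close> last.\<close>

lemma occupied_verts_iff:
  "v \<in> occupied_verts G t s T \<longleftrightarrow>
    v \<in> verts G \<and> (\<exists>n\<in>{1..k} \<rightarrow>\<^sub>E UNIV. T = chain_time v + cycles_time n)"
proof
  assume "v \<in> occupied_verts G t s T"
  then obtain p where p: "awalk s p v" "awalk_cost t p = T"
    by (auto simp: occupied_verts_def)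
  then show "v \<in> verts G \<and> (\<exists>n\<in>{1..k} \<rightarrow>\<^sub>E UNIV. T = chain_time v + cycles_time n)"
    using walk_time[OF p(1)] by auto
next
  assume "v \<in> verts G \<and> (\<exists>n\<in>{1..k} \<rightarrow>\<^sub>E UNIV. T = chain_time v + cycles_time n)"
  then obtain n where v: "v \<in> verts G" and n: "T = chain_time v + cycles_time n" by blast
  obtain p where p: "awalk s p s" "awalk_cost t p = cycles_time n"
    using closed_walk_times by blast
  show "v \<in> occupied_verts G t s T"
    using awalk_appendI[OF p(1) awalk_chain[OF v]] p(2) n
    unfolding occupied_verts_def by (intro CollectI exI[of _ "p @ chain v"]) auto
qed

lemma occupied_verts_subset: "occupied_verts G t s T \<subseteq> verts G"
  by (auto simp: occupied_verts_iff)

section \<open>Counting the endpoints\<close>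

text \<open>By independence, the arrival time at \<open>v\<close> determines the tuple, so at most
  one tuple arrives exactly at \<open>T\<close>.\<close>

lemma card_solutions_at:
  assumes v: "v \<in> verts G"
  shows "card {n \<in> sols (chain_time v) T. chain_time v + cycles_time n = T}
    = of_bool (v \<in> occupied_verts G t s T)"
proof (cases "v \<in> occupied_verts G t s T")
  case True
  then obtain n where n: "n \<in> {1..k} \<rightarrow>\<^sub>E UNIV" "T = chain_time v + cycles_time n"
    by (auto simp: occupied_verts_iff)
  have "m = n" if "m \<in> sols (chain_time v) T" "chain_time v + cycles_time m = T" for m
    using inj_onD[OF inj_on_cycles_time, of m n] that n by (auto simp: solutions_def)
  then have "{n \<in> sols (chain_time v) T. chain_time v + cycles_time n = T} = {n}"
    using n by (auto simp: solutions_def)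
  then show ?thesis using True by simp
next
  case False
  then have "{n \<in> sols (chain_time v) T. chain_time v + cycles_time n = T} = {}"
    using v by (auto simp: occupied_verts_iff solutions_def)
  then show ?thesis using False by (simp only: card.empty of_bool_eq)
qed

text \<open>A point of \<open>e\<close> at position \<open>x\<close> comes from a tuple that reaches
  the tail of \<open>e\<close> at time \<open>T - x\<close>. All tuples that have reached the tail
  by \<open>T\<close> count, except those already at or past the head and the one that is just at
  the tail.\<close>

lemma card_interior:
  fixes T :: real
  assumes e: "e \<in> arcs G"
  defines "X \<equiv> {x. 0 < x \<and> x < t e \<and> tail G e \<in> occupied_verts G t s (T - x)}"
  shows "finite X"
    and "int (card X) = int (card (sols (chain_time (tail G e)) T))
      - int (card (sols (chain_time (tail G e) + t e) T))
      - of_bool (tail G e \<in> occupied_verts G t s T)"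
proof -
  let ?b = "chain_time (tail G e)"
  \<comment> \<open>\<open>?L\<close> holds the tuples that have reached the head of
    \<open>e\<close> by \<open>T\<close>, \<open>?E\<close> those at the tail exactly at
    \<open>T\<close>.\<close>
  let ?S = "sols ?b T" and ?L = "sols (?b + t e) T" and ?E = "{n \<in> sols ?b T. ?b + cycles_time n = T}"
  let ?f = "\<lambda>n. T - (?b + cycles_time n)"
  have v: "tail G e \<in> verts G" using e by simp
  have te: "0 < t e" using t_pos[OF e] .
  have sub: "?L \<union> ?E \<subseteq> ?S" using te by (auto simp: solutions_def)
  have disj: "?L \<inter> ?E = {}" using te by (auto simp: solutions_def)
  have "?E \<subseteq> ?S" by blast
  then have fin_E: "finite ?E" using finite_sols by (rule finite_subset)
  have X: "X = ?f ` (?S - (?L \<union> ?E))"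
  proof (intro equalityI subsetI)
    fix x assume "x \<in> X"
    then obtain n where "0 < x" "x < t e" "n \<in> {1..k} \<rightarrow>\<^sub>E UNIV" "T - x = ?b + cycles_time n"
      by (auto simp: X_def occupied_verts_iff)
    then show "x \<in> ?f ` (?S - (?L \<union> ?E))"
      by (intro image_eqI[of _ _ n]) (auto simp: solutions_def)
  next
    fix x assume "x \<in> ?f ` (?S - (?L \<union> ?E))"
    then obtain n where x: "x = ?f n" and n: "n \<in> ?S - (?L \<union> ?E)" by blast
    then have "n \<in> {1..k} \<rightarrow>\<^sub>E UNIV" "?b + cycles_time n < T" "T < ?b + t e + cycles_time n"
      by (auto simp: solutions_def)
    then show "x \<in> X"
      using v x by (auto simp: X_def occupied_verts_iff)
  qed
  show "finite X" unfolding X using finite_sols by blast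
  \<comment> \<open>Independence again: different tuples give different positions on
    \<open>e\<close>.\<close>
  have "inj_on ?f (?S - (?L \<union> ?E))"
    using inj_on_cycles_time by (auto simp: inj_on_def solutions_def)
  then have "card X = card (?S - (?L \<union> ?E))" unfolding X by (rule card_image)
  moreover have "card (?S - (?L \<union> ?E)) = card ?S - card (?L \<union> ?E)"
    using finite_subset[OF sub finite_sols] sub by (rule card_Diff_subset)
  moreover have "card (?L \<union> ?E) \<le> card ?S"
    using finite_sols sub by (rule card_mono)
  moreover have "card (?L \<union> ?E) = card ?L + card ?E"
    using finite_sols fin_E disj by (rule card_Un_disjoint)
  moreover have "int (card ?E) = of_bool (tail G e \<in> occupied_verts G t s T)"
    using card_solutions_at[OF v, of T] by (simp only: of_nat_of_bool)
  ultimately show "int (card X) = int (card ?S) - int (card ?L) - of_bool (tail G e \<in> occupied_verts G t s T)"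
    by linarith
qed

lemma sum_arcs_by_tail:
  fixes f :: "'a \<Rightarrow> int"
  shows "(\<Sum>e\<in>arcs G. f (tail G e)) = (\<Sum>v\<in>verts G. int (out_degree G v) * f v)"
proof -
  have "(\<Sum>e\<in>arcs G. f (tail G e)) = (\<Sum>v\<in>verts G. \<Sum>e\<in>{e \<in> arcs G. tail G e = v}. f (tail G e))"
    by (intro sum.group[symmetric]) auto
  also have "\<dots> = (\<Sum>v\<in>verts G. int (out_degree G v) * f v)"
    by (intro sum.cong) (auto simp: out_degree_def out_arcs_def)
  finally show ?thesis .
qed

text \<open>An occupied vertex \<open>v\<close> is one endpoint itself but removes one from each arc
  leaving it, which leaves the correction \<open>out_degree G v - 1\<close>.\<close>

lemma num_endpoints_eq:
  "int (num_endpoints G t s T) =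
    (\<Sum>e\<in>arcs G. int (card (sols (chain_time (tail G e)) T))
      - int (card (sols (chain_time (tail G e) + t e) T)))
    - (\<Sum>v\<in>occupied_verts G t s T. int (out_degree G v) - 1)"
proof -
  let ?O = "occupied_verts G t s T"
  let ?X = "\<lambda>e. {x. 0 < x \<and> x < t e \<and> tail G e \<in> occupied_verts G t s (T - x)}"
  let ?V = "Vertex ` ?O :: ('a, 'b) graph_point set"
  let ?I = "\<Union>e\<in>arcs G. Interior e ` ?X e :: ('a, 'b) graph_point set"
  let ?N = "\<lambda>e. int (card (sols (chain_time (tail G e)) T))
      - int (card (sols (chain_time (tail G e) + t e) T))"
  have fin: "finite ?O" using finite_subset[OF occupied_verts_subset] by simp
  have "endpoints G t s T = ?V \<union> ?I"
    by (auto simp: endpoints_def)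
  moreover have "card (?V \<union> ?I) = card ?V + card ?I"
    using fin card_interior(1) by (intro card_Un_disjoint) auto
  moreover have "card ?V = card ?O" by (intro card_image) (auto simp: inj_on_def)
  moreover have "card ?I = (\<Sum>e\<in>arcs G. card (Interior e ` ?X e :: ('a, 'b) graph_point set))"
    using card_interior(1) by (intro card_UN_disjoint) auto
  moreover have "\<dots> = (\<Sum>e\<in>arcs G. card (?X e))"
    by (intro sum.cong refl card_image) (auto simp: inj_on_def)
  ultimately have "int (num_endpoints G t s T) = int (card ?O) + (\<Sum>e\<in>arcs G. int (card (?X e)))"
    by (simp add: num_endpoints_def)
  moreover have "(\<Sum>e\<in>arcs G. int (card (?X e))) = (\<Sum>e\<in>arcs G. ?N e - of_bool (tail G e \<in> ?O))"
    by (intro sum.cong refl card_interior(2))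
  moreover have "\<dots> = (\<Sum>e\<in>arcs G. ?N e) - (\<Sum>e\<in>arcs G. of_bool (tail G e \<in> ?O))"
    by (rule sum_subtractf)
  moreover have "(\<Sum>e\<in>arcs G. of_bool (tail G e \<in> ?O) :: int)
      = (\<Sum>v\<in>verts G. int (out_degree G v) * of_bool (v \<in> ?O))"
    by (rule sum_arcs_by_tail)
  moreover have "\<dots> = (\<Sum>v\<in>?O. int (out_degree G v))"
    using occupied_verts_subset by (intro sum.mono_neutral_cong_right) auto
  moreover have "(\<Sum>v\<in>?O. int (out_degree G v) - 1) = (\<Sum>v\<in>?O. int (out_degree G v)) - int (card ?O)"
    by (simp add: sum_subtractf)
  ultimately show ?thesis by linarith
qed

section \<open>Evaluating the formula\<close>

text \<open>At \<open>s\<close> the chain is empty and each cycle contributes just its return arc.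
  Any other \<open>v\<close> has a single entering arc in the whole graph, and it already lies on
  the chain to \<open>v\<close>.\<close>

lemma in_degree_chain_cycles:
  assumes v: "v \<in> verts G" and I: "I \<subseteq> {1..k}"
  shows "in_degree (arcs_subgraph G (set (chain v) \<union> (\<Union>i\<in>I. c i))) v = (if v = s then card I else 1)"
proof -
  let ?A = "set (chain v) \<union> (\<Union>i\<in>I. c i)"
  have "c i \<subseteq> arcs G" if "i \<in> I" for i
    using cycle_subset[OF subsetD[OF I that]] .
  then have A: "?A \<subseteq> arcs G" using awalk_chain[OF v] by (auto simp: awalk_def)
  have deg: "in_degree (arcs_subgraph G ?A) v = card {e \<in> ?A. head G e = v}"
    by (simp add: in_degree_def in_arcs_def arcs_subgraph_def)
  show ?thesis
  proof (cases "v = s")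
    case True
    have "{e \<in> ?A. head G e = s} = (\<Union>i\<in>I. c i \<inter> back_arcs)"
      using A unfolding True chain_source by (auto simp: in_arcs_def)
    also have "\<dots> = (\<Union>i\<in>I. {ret i})"
      using I by (intro SUP_cong refl cycle_back_arcs) auto
    finally have "{e \<in> ?A. head G e = s} = ret ` I" by auto
    moreover have "inj_on ret I" using inj_on_subset[OF bij_betw_imp_inj_on[OF bij_betw_ret] I] .
    ultimately show ?thesis unfolding deg using True by (simp add: card_image)
  next
    case False
    then have "v \<in> head G ` (arcs G - back_arcs)"
      using v unfolding bij_betw_imp_surj_on[OF bij_betw_head] by simp
    then obtain e where e: "e \<in> arcs G - back_arcs" "head G e = v" by blast
    have "f = e" if "f \<in> ?A" "head G f = v" for f
    proof (rule inj_onD[OF bij_betw_imp_inj_on[OF bij_betw_head]])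
      show "f \<in> arcs G - back_arcs" using that A False by (auto simp: in_arcs_def)
    qed (use that e in auto)
    moreover have "e \<in> set (chain v)" using in_arcs_chain[of v] e v False by blast
    ultimately have "{e \<in> ?A. head G e = v} = {e}" using e(2) by blast
    then show ?thesis unfolding deg using False by simp
  qed
qed

text \<open>The out-degree part is regrouped by tails. In the in-degree part, \<open>s\<close>
  accounts for the arcs entering it through the cycle times, and every other vertex for its single
  entering arc.\<close>

lemma sum_formula_eq:
  "(\<Sum>v\<in>verts G. \<Sum>I\<in>Pow {1..k}.
      (int (out_degree G v) - int (in_degree (arcs_subgraph G (set (chain v) \<union> (\<Union>i\<in>I. c i))) v))
      * int (count_solutions (chain_time v) I (\<lambda>i. sum t (c i)) T))
   = (\<Sum>e\<in>arcs G. int (card (sols (chain_time (tail G e)) T))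
      - int (card (sols (chain_time (tail G e) + t e) T)))"
proof -
  let ?M = "\<lambda>b. int (card (sols b T))"
  let ?D = "\<lambda>v. \<Sum>I\<in>Pow {1..k}. int (in_degree (arcs_subgraph G (set (chain v) \<union> (\<Union>i\<in>I. c i))) v)
      * int (count_solutions (chain_time v) I (\<lambda>i. sum t (c i)) T)"
  note support = sum_solutions_support[OF finite_atLeastAtMost cycle_time_pos, symmetric]
  have total: "(\<Sum>I\<in>Pow {1..k}. int (out_degree G v) * int (count_solutions (chain_time v) I (\<lambda>i. sum t (c i)) T))
      = int (out_degree G v) * ?M (chain_time v)" for v
    by (subst support) simp_all
  have D: "?D v = (if v = s then \<Sum>i\<in>{1..k}. ?M (sum t (c i)) else ?M (chain_time v))" if v: "v \<in> verts G" for v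
  proof -
    have "?D v = (\<Sum>I\<in>Pow {1..k}. (if v = s then int (card I) else 1)
        * int (count_solutions (chain_time v) I (\<lambda>i. sum t (c i)) T))"
      by (intro sum.cong refl) (simp add: in_degree_chain_cycles[OF v])
    also have "\<dots> = (\<Sum>n\<in>sols (chain_time v) T. if v = s then int (card {i \<in> {1..k}. n i \<noteq> 0}) else 1)"
      by (subst support) simp_all
    \<comment> \<open>The constant 0 is the time of the empty chain to \<open>s\<close>; counting
      supports there shifts it to the cycle times.\<close>
    also have "\<dots> = (if v = s then \<Sum>i\<in>{1..k}. ?M (sum t (c i)) else ?M (chain_time v))"
      using sum_card_support_solutions[of "{1..k}" "\<lambda>i. sum t (c i)" 0 T] cycle_time_pos
      by (simp add: chain_source flip: of_nat_sum)
    finally show ?thesis .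
  qed
  have "(\<Sum>v\<in>verts G. ?D v) = ?D s + (\<Sum>v\<in>verts G - {s}. ?D v)"
    using finite_verts source_in_verts by (rule sum.remove)
  moreover have "?D s = (\<Sum>i\<in>{1..k}. ?M (sum t (c i)))"
    using D[OF source_in_verts] by (simp only: if_True simp_thms)
  \<comment> \<open>Sums over cycles and vertices now become sums over arcs, through
    \<open>ret\<close> for the arcs into \<open>s\<close> and through heads for the others.\<close>
  moreover have "\<dots> = (\<Sum>i\<in>{1..k}. ?M (chain_time (tail G (ret i)) + t (ret i)))"
    by (intro sum.cong refl) (simp only: cycle_time)
  moreover have "\<dots> = (\<Sum>e\<in>back_arcs. ?M (chain_time (tail G e) + t e))"
    using bij_betw_ret by (rule sum.reindex_bij_betw)
  moreover have "(\<Sum>v\<in>verts G - {s}. ?D v) = (\<Sum>v\<in>verts G - {s}. ?M (chain_time v))"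
    by (intro sum.cong refl) (simp only: D Diff_iff insert_iff if_False empty_iff simp_thms)
  moreover have "\<dots> = (\<Sum>e\<in>arcs G - back_arcs. ?M (chain_time (head G e)))"
    using bij_betw_head by (rule sum.reindex_bij_betw[symmetric])
  moreover have "\<dots> = (\<Sum>e\<in>arcs G - back_arcs. ?M (chain_time (tail G e) + t e))"
    by (intro sum.cong refl) (simp only: chain_head awalk_cost_append awalk_cost_Cons awalk_cost_Nil add_0_right)
  moreover have "(\<Sum>e\<in>arcs G. ?M (chain_time (tail G e) + t e))
      = (\<Sum>e\<in>arcs G - back_arcs. ?M (chain_time (tail G e) + t e))
        + (\<Sum>e\<in>back_arcs. ?M (chain_time (tail G e) + t e))"
    by (rule sum.subset_diff) (auto simp: in_arcs_def)
  ultimately have in_part: "(\<Sum>v\<in>verts G. ?D v) = (\<Sum>e\<in>arcs G. ?M (chain_time (tail G e) + t e))"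
    by linarith
  have out_part: "(\<Sum>v\<in>verts G. int (out_degree G v) * ?M (chain_time v))
      = (\<Sum>e\<in>arcs G. ?M (chain_time (tail G e)))"
    by (rule sum_arcs_by_tail[symmetric])
  show ?thesis
    by (simp only: left_diff_distrib sum_subtractf total in_part out_part)
qed

section \<open>Times immediately after \<open>T\<close>\<close>

text \<open>An arrival at \<open>T' > T\<close> comes from a tuple that solves the inequality for
  \<open>T'\<close> but not for \<open>T\<close>, while the solution sets agree for
  \<open>T'\<close> close to \<open>T\<close>.\<close>

lemma eventually_no_occupied_verts: "\<forall>\<^sub>F T' in at_right T. occupied_verts G t s T' = {}"
proof -
  have "\<forall>\<^sub>F T' in at_right T. \<forall>v\<in>verts G. sols (chain_time v) T' = sols (chain_time v) T"
    using cycle_time_pos by (intro eventually_ball_finite ballI eventually_solutions_at_right) auto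
  then show ?thesis
    using eventually_at_right_less[of T]
  proof eventually_elim
    case (elim T')
    have False if v: "v \<in> occupied_verts G t s T'" for v
    proof -
      obtain n where n: "n \<in> {1..k} \<rightarrow>\<^sub>E UNIV" "T' = chain_time v + cycles_time n" and "v \<in> verts G"
        using v by (auto simp: occupied_verts_iff)
      then have "n \<in> sols (chain_time v) T" using elim(1) by (auto simp: solutions_def)
      with n elim(2) show False by (simp add: solutions_def)
    qed
    then show ?case by blast
  qed
qed

text \<open>The correction in \<open>num_endpoints_eq\<close> is an empty sum at \<open>T'\<close>,
  and the counts keep their values at \<open>T\<close>.\<close>

lemma eventually_num_endpoints:
  "\<forall>\<^sub>F T' in at_right T. int (num_endpoints G t s T') =
    (\<Sum>e\<in>arcs G. int (card (sols (chain_time (tail G e)) T))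
      - int (card (sols (chain_time (tail G e) + t e) T)))"
proof -
  have "\<forall>\<^sub>F T' in at_right T. \<forall>e\<in>arcs G. sols (chain_time (tail G e)) T' = sols (chain_time (tail G e)) T
      \<and> sols (chain_time (tail G e) + t e) T' = sols (chain_time (tail G e) + t e) T"
    using cycle_time_pos
    by (intro eventually_ball_finite ballI eventually_conj eventually_solutions_at_right) auto
  then show ?thesis
    using eventually_no_occupied_verts[of T]
    by eventually_elim (simp add: num_endpoints_eq)
qed

end

text \<open>The formula and the number of endpoints at \<open>T\<close> differ by the sum of
  \<open>out_degree G v - 1\<close> over the occupied vertices. Hence equality holds at
  \<open>T\<close> when these degrees are 1, and the value of the formula at \<open>T\<close> is
  always attained immediately afterwards.\<close>

theorem theorem1:
  fixes G :: "('a, 'b) pre_digraph" and t :: "'b \<Rightarrow> real" and s :: 'a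
    and k :: nat and c :: "nat \<Rightarrow> 'b set" and l :: "'a \<Rightarrow> 'b list" and T :: real
  assumes "one_way_sperner G s"
    and "\<And>e. e \<in> arcs G \<Longrightarrow> 0 < t e"
    and "bij_betw c {1..k} (elem_cycles G)"
    and "\<And>v. v \<in> verts G \<Longrightarrow> l v = simple_chain G s v"
    and "rat_independent_family
           (case_sum (\<lambda>i. sum t (c i)) (\<lambda>v. wf_digraph.awalk_cost t (l v)))
           ({1..k} <+> (verts G - {s}))"
    and "0 \<le> T"
  shows "let F = (\<Sum>v\<in>verts G. \<Sum>I\<in>Pow {1..k}.
                   (int (out_degree G v)
                    - int (in_degree (arcs_subgraph G (set (l v) \<union> (\<Union>i\<in>I. c i))) v))
                   * int (count_solutions (wf_digraph.awalk_cost t (l v)) I (\<lambda>i. sum t (c i)) T))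
         in ((\<forall>v\<in>occupied_verts G t s T. out_degree G v = 1) \<longrightarrow> int (num_endpoints G t s T) = F)
            \<and> (\<forall>\<^sub>F T' in at_right T. int (num_endpoints G t s T') = F)"
proof -
  \<comment> \<open>The injection \<open>Inl\<close> selects the cycle times from the joint family
    of cycles and chains.\<close>
  have "rat_independent_family
      (case_sum (\<lambda>i. sum t (c i)) (\<lambda>v. wf_digraph.awalk_cost t (l v)) \<circ> Inl) {1..k}"
    using assms(5) by (rule rat_independent_family_reindex_subset) auto
  then have "rat_independent_family (\<lambda>i. sum t (c i)) {1..k}"
    by (simp add: comp_def)
  moreover have "fin_digraph G" using assms(1) by (simp add: one_way_sperner_def)
  ultimately interpret sperner_metric_graph G s t k c
    using assms(1-3)
    by (simp add: sperner_metric_graph_def sperner_digraph_def sperner_digraph_axioms_def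
        sperner_metric_graph_axioms_def)
  let ?F = "\<Sum>v\<in>verts G. \<Sum>I\<in>Pow {1..k}.
      (int (out_degree G v) - int (in_degree (arcs_subgraph G (set (l v) \<union> (\<Union>i\<in>I. c i))) v))
      * int (count_solutions (awalk_cost t (l v)) I (\<lambda>i. sum t (c i)) T)"
  have F: "?F = (\<Sum>e\<in>arcs G. int (card (sols (chain_time (tail G e)) T))
      - int (card (sols (chain_time (tail G e) + t e) T)))"
    unfolding sum_formula_eq[symmetric] using assms(4) by (intro sum.cong refl) simp
  show ?thesis
    unfolding Let_def F
    using eventually_num_endpoints num_endpoints_eq[of T] by simp
qed

end
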